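(* Let $N_1$ and $N_2$ be disjoint non-empty finite index sets, and for $k=1,2$ and each $n_k\in N_k$ let $\mathcal{D}_{n_k}$ be a coherent set of desirable gambles on $\mathcal{X}_{n_k}$. Let $\mathcal{D}_{N_1}:=\otimes_{n_1\in N_1}\mathcal{D}_{n_1}$ and $\mathcal{D}_{N_2}:=\otimes_{n_2\in N_2}\mathcal{D}_{n_2}$. Then $$\mathcal{D}_{N_1}\otimes\mathcal{D}_{N_2}=\otimes_{n\in N_1\cup N_2}\mathcal{D}_n .$$
   Context: For each $n\in N_1\cup N_2$, $\mathcal{X}_n$ is a finite non-empty set; for $R\subseteq N_1\cup N_2$, $\mathcal{X}_R:=\prod_{r\in R}\mathcal{X}_r$, with $\mathcal{X}_\emptyset$ a one-point set. For a finite non-empty set $\mathcal{Z}$, a gamble on $\mathcal{Z}$ is a function $\mathcal{Z}\to\mathbb{R}$; $\mathcal{G}(\mathcal{Z})$ is the linear space of all gambles on $\mathcal{Z}$. Write $f\geq g$ for pointwise inequality and $f>g$ if $f\geq g$ and $f\neq g$; $\mathcal{G}(\mathcal{Z})_{>0}:=\{f\in\mathcal{G}(\mathcal{Z}):f>0\}$. For $\mathcal{A}\subseteq\mathcal{G}(\mathcal{Z})$, $\mathrm{posi}(\mathcal{A}):=\{\sum_{k=1}^{m}\lambda_kf_k : m\geq 1,\ f_k\in\mathcal{A},\ \lambda_k>0\}$. A set of desirable gambles $\mathcal{D}\subseteq\mathcal{G}(\mathcal{Z})$ is coherent if (D1) $0\notin\mathcal{D}$; (D2) $\mathcal{G}(\mathcal{Z})_{>0}\subseteq\mathcal{D}$;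 (D3) $\mathrm{posi}(\mathcal{D})=\mathcal{D}$. A gamble $f$ on $\mathcal{X}_R$ is identified with its cylindrical extension $x_S\mapsto f(x_R)$ on $\mathcal{X}_S$ whenever $R\subseteq S$; $\mathbb{I}_{\{x_R\}}$ denotes the indicator of $x_R\in\mathcal{X}_R$ (identified in the same way with a gamble on $\mathcal{X}_S$). For a finite non-empty index set $N$, finite non-empty sets $\mathcal{X}_n$ and coherent $\mathcal{D}_n\subseteq\mathcal{G}(\mathcal{X}_n)$, $n\in N$, define $$\mathcal{A}^{\mathrm{irr}}_{N\setminus\{n\}\to\{n\}}:=\mathrm{posi}\left(\{\mathbb{I}_{\{x_{N\setminus\{n\}}\}}g : g\in\mathcal{D}_n,\ x_{N\setminus\{n\}}\in\mathcal{X}_{N\setminus\{n\}}\}\right),\qquad \otimes_{n\in N}\mathcal{D}_n:=\mathrm{posi}\Big(\mathcal{G}(\mathcal{X}_N)_{>0}\cup\bigcup_{n\in N}\mathcal{A}^{\mathrm{irr}}_{N\setminus\{n\}\to\{n\}}\Big).$$ The set $\mathcal{D}_{N_1}\otimes\mathcal{D}_{N_2}$ is this construction applied to the two-element index set $\{N_1,N_2\}$ with possibility spaces $\mathcal{X}_{N_1}$ and $\mathcal{X}_{N_2}$ (the sets $\mathcal{D}_{N_1}$, $\mathcal{D}_{N_2}$ are coherent), where $\mathcal{X}_{N_1}\times\mathcal{X}_{N_2}$ is identified with $\mathcal{X}_{N_1\cup N_2}$. *)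

theory Defs
  imports Complex_Main "HOL-Library.FuncSet" "HOL-Library.Indicator_Function"
begin

text \<open>
  Gambles on a set Z are real functions that are \<^const>\<open>undefined\<close> outside Z, so that
  equality of gambles is equality of functions Z to the reals; all operations on gambles
  are therefore restricted to Z explicitly.
  The possibility spaces \<open>X n\<close> are subsets of one type \<open>'a\<close>, and the
  product space of \<open>R\<close> is \<open>PiE R X\<close>; for \<open>R = {}\<close> it has exactly one point.
\<close>

definition gambles :: "'z set \<Rightarrow> ('z \<Rightarrow> real) set" where
  "gambles Z = Z \<rightarrow>\<^sub>E UNIV"

definition zero_gamble :: "'z set \<Rightarrow> 'z \<Rightarrow> real" where
  "zero_gamble Z = (\<lambda>z\<in>Z. 0)"

definition pos_gambles :: "'z set \<Rightarrow> ('z \<Rightarrow> real) set" where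
  "pos_gambles Z = {f \<in> gambles Z. (\<forall>z\<in>Z. f z \<ge> zero_gamble Z z) \<and> f \<noteq> zero_gamble Z}"

definition posi :: "'z set \<Rightarrow> ('z \<Rightarrow> real) set \<Rightarrow> ('z \<Rightarrow> real) set" where
  "posi Z A = {(\<lambda>z\<in>Z. \<Sum>k=1..m. c k * f k z) | (m :: nat) c f.
                 m \<ge> 1 \<and> (\<forall>k\<in>{1..m}. f k \<in> A \<and> c k > 0)}"

definition coherent :: "'z set \<Rightarrow> ('z \<Rightarrow> real) set \<Rightarrow> bool" where
  "coherent Z D \<longleftrightarrow>
     D \<subseteq> gambles Z \<and> zero_gamble Z \<notin> D \<and> pos_gambles Z \<subseteq> D \<and> posi Z D = D"

text \<open>
  The generators below are products of the cylindrical extensions to \<open>PiE N X\<close> of the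
  indicator of a point \<open>y\<close> of \<open>PiE (N - {n}) X\<close> and of a gamble \<open>g\<close> on \<open>X n\<close>.
\<close>

definition irr_gambles ::
    "('i \<Rightarrow> 'a set) \<Rightarrow> 'i set \<Rightarrow> ('i \<Rightarrow> ('a \<Rightarrow> real) set) \<Rightarrow> 'i \<Rightarrow> (('i \<Rightarrow> 'a) \<Rightarrow> real) set" where
  "irr_gambles X N D n =
     posi (PiE N X)
       {(\<lambda>x\<in>PiE N X. indicator {y} (restrict x (N - {n})) * g (x n)) | g y.
          g \<in> D n \<and> y \<in> PiE (N - {n}) X}"

definition ind_nat_ext ::
    "('i \<Rightarrow> 'a set) \<Rightarrow> 'i set \<Rightarrow> ('i \<Rightarrow> ('a \<Rightarrow> real) set) \<Rightarrow> (('i \<Rightarrow> 'a) \<Rightarrow> real) set" where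
  "ind_nat_ext X N D =
     posi (PiE N X) (pos_gambles (PiE N X) \<union> (\<Union>n\<in>N. irr_gambles X N D n))"

text \<open>
  Identification of \<open>PiE (\<Union>\<R>) X\<close> with the product, over the index set \<open>\<R>\<close> of blocks,
  of the spaces \<open>PiE R X\<close>, and the induced identification of gambles. It is a bijection
  when the blocks are pairwise disjoint; below this is recorded for two blocks.
\<close>

definition regroup :: "'i set set \<Rightarrow> ('i \<Rightarrow> 'a) \<Rightarrow> 'i set \<Rightarrow> 'i \<Rightarrow> 'a" where
  "regroup \<R> x = (\<lambda>R\<in>\<R>. restrict x R)"

definition flatten_gamble ::
    "('i \<Rightarrow> 'a set) \<Rightarrow> 'i set set \<Rightarrow> (('i set \<Rightarrow> 'i \<Rightarrow> 'a) \<Rightarrow> real) \<Rightarrow> ('i \<Rightarrow> 'a) \<Rightarrow> real" where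
  "flatten_gamble X \<R> f = (\<lambda>x\<in>PiE (\<Union>\<R>) X. f (regroup \<R> x))"

lemma bij_betw_regroup:
  assumes disj: "N1 \<inter> N2 = {}"
  shows "bij_betw (regroup {N1, N2}) (PiE (N1 \<union> N2) X) (PiE {N1, N2} (\<lambda>R. PiE R X))"
proof -
  let ?S = "PiE (N1 \<union> N2) X" and ?T = "PiE {N1, N2} (\<lambda>R. PiE R X)"
  define u where "u z = (\<lambda>i\<in>N1 \<union> N2. if i \<in> N1 then z N1 i else z N2 i)"
    for z :: "'a set \<Rightarrow> 'a \<Rightarrow> 'b"
  have left: "u (regroup {N1, N2} x) = x" if x: "x \<in> ?S" for x
  proof
    fix i
    show "u (regroup {N1, N2} x) i = x i"
      using PiE_arb[OF x, of i] by (simp add: u_def regroup_def)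
  qed
  have right: "regroup {N1, N2} (u z) = z" if z: "z \<in> ?T" for z
  proof -
    have ext: "z N1 \<in> extensional N1" "z N2 \<in> extensional N2"
      using PiE_mem[OF z, of N1] PiE_mem[OF z, of N2] by (simp_all add: PiE_def)
    have "restrict (u z) N1 = restrict (z N1) N1"
      by (rule restrict_ext) (simp add: u_def)
    then have 1: "restrict (u z) N1 = z N1"
      using ext by (simp add: extensional_restrict)
    have "i \<notin> N1" if "i \<in> N2" for i
      using disj that by blast
    then have "restrict (u z) N2 = restrict (z N2) N2"
      by (intro restrict_ext) (simp add: u_def)
    then have 2: "restrict (u z) N2 = z N2"
      using ext by (simp add: extensional_restrict)
    have "regroup {N1, N2} (u z) = restrict z {N1, N2}"
      unfolding regroup_def by (rule restrict_ext) (use 1 2 in blast)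
    also have "\<dots> = z"
      using z by (rule PiE_restrict)
    finally show ?thesis .
  qed
  have mem: "regroup {N1, N2} x \<in> ?T" if x: "x \<in> ?S" for x
    unfolding regroup_def
  proof (rule restrict_PiE_iff[THEN iffD2], rule ballI)
    fix R assume "R \<in> {N1, N2}"
    then have "R \<subseteq> N1 \<union> N2"
      by blast
    then show "restrict x R \<in> PiE R X"
      using PiE_mem[OF x] by (simp add: restrict_PiE_iff subset_iff)
  qed
  have mem': "u z \<in> ?S" if z: "z \<in> ?T" for z
  proof -
    have 1: "z N1 \<in> PiE N1 X" and 2: "z N2 \<in> PiE N2 X"
      using PiE_mem[OF z, of N1] PiE_mem[OF z, of N2] by simp_all
    show ?thesis
      unfolding u_def restrict_PiE_iff using PiE_mem[OF 1] PiE_mem[OF 2] by auto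
  qed
  show ?thesis
    by (rule bij_betw_byWitness[where f' = u]) (simp_all add: left right mem mem' image_subset_iff)
qed

lemma bij_betw_gambles_compose:
  assumes b: "bij_betw h S T"
  shows "bij_betw (\<lambda>f. \<lambda>x\<in>S. f (h x)) (gambles T) (gambles S)"
proof (rule bij_betw_byWitness[where f' = "\<lambda>g. \<lambda>z\<in>T. g (inv_into S h z)"])
  have "\<And>z. z \<in> T \<Longrightarrow> h (inv_into S h z) = z" "\<And>z. z \<in> T \<Longrightarrow> inv_into S h z \<in> S"
    using b bij_betw_inv_into_right bij_betwE bij_betw_inv_into by metis+
  then show "\<forall>f\<in>gambles T. (\<lambda>z\<in>T. (\<lambda>x\<in>S. f (h x)) (inv_into S h z)) = f"
    by (auto simp: gambles_def fun_eq_iff PiE_iff extensional_def)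
  have "\<And>x. x \<in> S \<Longrightarrow> inv_into S h (h x) = x" "\<And>x. x \<in> S \<Longrightarrow> h x \<in> T"
    using b bij_betw_inv_into_left bij_betwE by metis+
  then show "\<forall>g\<in>gambles S. (\<lambda>x\<in>S. (\<lambda>z\<in>T. g (inv_into S h z)) (h x)) = g"
    by (auto simp: gambles_def fun_eq_iff PiE_iff extensional_def)
qed (auto simp: gambles_def)

lemma bij_betw_flatten_gamble:
  assumes "N1 \<inter> N2 = {}"
  shows "bij_betw (flatten_gamble X {N1, N2})
           (gambles (PiE {N1, N2} (\<lambda>R. PiE R X))) (gambles (PiE (N1 \<union> N2) X))"
proof -
  have "flatten_gamble X {N1, N2} = (\<lambda>f. \<lambda>x\<in>PiE (N1 \<union> N2) X. f (regroup {N1, N2} x))"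
    by (rule ext) (simp add: flatten_gamble_def)
  then show ?thesis
    using bij_betw_gambles_compose[OF bij_betw_regroup[OF assms, of X]] by (simp only:)
qed

end

theory Submission
  imports Defs
begin

text \<open>
  An independent natural extension is the least convex cone containing the positive gambles
  and the generators (indicator of a point of \<open>N - {n}\<close>) \<open>\<times>\<close> (gamble in \<open>D n\<close>). The indicator
  of a point of \<open>(R \<union> S) - {n}\<close> with \<open>n \<in> R\<close> is the indicator of a point of \<open>S\<close> times that of
  a point of \<open>R - {n}\<close>, so the generators for \<open>R \<union> S\<close> are exactly the indicators of points of
  \<open>S\<close> times the generators for \<open>R\<close>. Both inclusions follow from leastness,
  since images and preimages of cones under linear maps are cones.
\<close>

section \<open>Cones of gambles\<close>

text \<open>Only strictly positive scalars occur and the zero gamble may be absent, in line with the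
  coefficients in \<open>posi\<close>.\<close>

definition gamble_cone :: "'z set \<Rightarrow> ('z \<Rightarrow> real) set \<Rightarrow> bool" where
  "gamble_cone Z K \<longleftrightarrow> K \<subseteq> gambles Z \<and>
     (\<forall>f\<in>K. \<forall>g\<in>K. (\<lambda>z\<in>Z. f z + g z) \<in> K) \<and> (\<forall>c>0. \<forall>f\<in>K. (\<lambda>z\<in>Z. c * f z) \<in> K)"

lemma gamble_coneI:
  assumes "K \<subseteq> gambles Z"
    and "\<And>f g. f \<in> K \<Longrightarrow> g \<in> K \<Longrightarrow> (\<lambda>z\<in>Z. f z + g z) \<in> K"
    and "\<And>c f. c > 0 \<Longrightarrow> f \<in> K \<Longrightarrow> (\<lambda>z\<in>Z. c * f z) \<in> K"
  shows "gamble_cone Z K"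
  using assms by (simp add: gamble_cone_def)

lemma gamble_coneD:
  assumes "gamble_cone Z K"
  shows gamble_cone_subset: "K \<subseteq> gambles Z"
    and gamble_cone_add: "f \<in> K \<Longrightarrow> g \<in> K \<Longrightarrow> (\<lambda>z\<in>Z. f z + g z) \<in> K"
    and gamble_cone_scale: "c > 0 \<Longrightarrow> f \<in> K \<Longrightarrow> (\<lambda>z\<in>Z. c * f z) \<in> K"
  using assms by (simp_all add: gamble_cone_def)

lemma restrict_in_gambles [simp]: "restrict f Z \<in> gambles Z"
  by (simp add: gambles_def)

lemma gambles_restrict: "f \<in> gambles Z \<Longrightarrow> restrict f Z = f"
  by (simp add: gambles_def PiE_restrict)

section \<open>The positive hull as the least cone\<close>

lemma posiE:
  assumes "h \<in> posi Z A"
  obtains m :: nat and c f where "h = (\<lambda>z\<in>Z. \<Sum>k=1..m. c k * f k z)"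
    and "m \<ge> 1" and "\<forall>k\<in>{1..m}. f k \<in> A \<and> c k > 0"
  using assms unfolding posi_def mem_Collect_eq by (elim exE conjE) (rule that)

text \<open>Induction on the number of terms. It starts at one term, since the empty sum would be
  the zero gamble, which need not lie in \<open>K\<close>.\<close>

lemma posi_least:
  assumes K: "gamble_cone Z K" and A: "A \<subseteq> K"
  shows "posi Z A \<subseteq> K"
proof
  fix h assume "h \<in> posi Z A"
  then obtain m :: nat and c f where h: "h = (\<lambda>z\<in>Z. \<Sum>k=1..m. c k * f k z)"
    and m: "m \<ge> 1" and cf: "\<forall>k\<in>{1..m}. f k \<in> A \<and> c k > 0"
    by (rule posiE)
  from m cf have "(\<lambda>z\<in>Z. \<Sum>k=1..m. c k * f k z) \<in> K"
  proof (induction m rule: nat_induct_at_least)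
    case base
    have "(\<lambda>z\<in>Z. \<Sum>k=1..1. c k * f k z) = (\<lambda>z\<in>Z. c 1 * f 1 z)"
      by (rule restrict_ext) simp
    also have "\<dots> \<in> K"
      by (rule gamble_cone_scale[OF K]) (use base A in auto)
    finally show ?case .
  next
    case (Suc m)
    have "(\<lambda>z\<in>Z. \<Sum>k=1..m. c k * f k z) \<in> K"
      by (rule Suc.IH) (use Suc.prems in auto)
    moreover have "(\<lambda>z\<in>Z. c (Suc m) * f (Suc m) z) \<in> K"
      using Suc.prems A by (intro gamble_cone_scale[OF K]) auto
    ultimately have "(\<lambda>z\<in>Z. (\<lambda>z\<in>Z. \<Sum>k=1..m. c k * f k z) z
        + (\<lambda>z\<in>Z. c (Suc m) * f (Suc m) z) z) \<in> K"
      by (rule gamble_cone_add[OF K])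
    also have "(\<lambda>z\<in>Z. (\<lambda>z\<in>Z. \<Sum>k=1..m. c k * f k z) z
        + (\<lambda>z\<in>Z. c (Suc m) * f (Suc m) z) z) = (\<lambda>z\<in>Z. \<Sum>k=1..Suc m. c k * f k z)"
      by (rule restrict_ext) simp
    finally show ?case .
  qed
  then show "h \<in> K" by (simp add: h)
qed

text \<open>Each element is its own one-term combination with coefficient 1. Since
  \<open>posi\<close> restricts to \<open>Z\<close>, getting the element itself back uses that it is
  undefined outside \<open>Z\<close>.\<close>

lemma posi_superset:
  assumes "A \<subseteq> gambles Z"
  shows "A \<subseteq> posi Z A"
proof
  fix f assume f: "f \<in> A"
  then have eq: "f = (\<lambda>z\<in>Z. \<Sum>k=1..1::nat. 1 * f z)"
    using assms gambles_restrict[of f Z] by auto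
  show "f \<in> posi Z A"
    unfolding posi_def mem_Collect_eq
    by (intro exI[of _ "1::nat"] exI[of _ "\<lambda>_. 1"] exI[of _ "\<lambda>_. f"] conjI, rule eq)
      (use f in simp_all)
qed

lemma gamble_cone_posi: "gamble_cone Z (posi Z A)"
proof (rule gamble_coneI)
  show "posi Z A \<subseteq> gambles Z"
    by (auto simp: posi_def)
next
  fix f g assume f: "f \<in> posi Z A" and g: "g \<in> posi Z A"
  obtain m :: nat and c p where
    f: "f = (\<lambda>z\<in>Z. \<Sum>k=1..m. c k * p k z)" and m: "m \<ge> 1"
      "\<forall>k\<in>{1..m}. p k \<in> A \<and> c k > 0"
    using f by (rule posiE)
  obtain n :: nat and d q where
    g: "g = (\<lambda>z\<in>Z. \<Sum>k=1..n. d k * q k z)" and n: "n \<ge> 1"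
      "\<forall>k\<in>{1..n}. q k \<in> A \<and> d k > 0"
    using g by (rule posiE)
  \<comment> \<open>Concatenation of the two combinations: indices 1 to \<open>m\<close> carry the
    first one, indices \<open>m + 1\<close> to \<open>m + n\<close> carry the second one shifted by
    \<open>m\<close>.\<close>
  define e where "e k = (if k \<le> m then c k else d (k - m))" for k
  define r where "r k = (if k \<le> m then p k else q (k - m))" for k
  have "(\<Sum>k=1..m+n. e k * r k z) = (\<Sum>k=1..m. c k * p k z) + (\<Sum>k=1..n. d k * q k z)" for z
  proof -
    have "(\<Sum>k=1..m+n. e k * r k z)
        = (\<Sum>k=1..m. e k * r k z) + (\<Sum>k=m+1..m+n. e k * r k z)"
      by (rule sum.ub_add_nat) simp
    also have "(\<Sum>k=m+1..m+n. e k * r k z) = (\<Sum>k=1..n. e (k + m) * r (k + m) z)"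
      using sum.shift_bounds_cl_nat_ivl[of "\<lambda>k. e k * r k z" 1 m n] by (simp add: add.commute)
    finally show ?thesis by (simp add: e_def r_def)
  qed
  then have "(\<lambda>z\<in>Z. f z + g z) = (\<lambda>z\<in>Z. \<Sum>k=1..m+n. e k * r k z)"
    by (intro restrict_ext) (simp add: f g)
  moreover have "\<forall>k\<in>{1..m+n}. r k \<in> A \<and> e k > 0"
  proof
    fix k assume "k \<in> {1..m+n}"
    then have "k \<le> m \<and> k \<in> {1..m} \<or> \<not> k \<le> m \<and> k - m \<in> {1..n}" by auto
    with m(2) n(2) show "r k \<in> A \<and> e k > 0" by (auto simp: e_def r_def)
  qed
  moreover have "m + n \<ge> 1" using m by simp
  ultimately show "(\<lambda>z\<in>Z. f z + g z) \<in> posi Z A"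
    unfolding posi_def mem_Collect_eq by blast
next
  fix a :: real and f assume a: "a > 0" and f: "f \<in> posi Z A"
  obtain m :: nat and c p where
    f: "f = (\<lambda>z\<in>Z. \<Sum>k=1..m. c k * p k z)" and m: "m \<ge> 1"
      "\<forall>k\<in>{1..m}. p k \<in> A \<and> c k > 0"
    using f by (rule posiE)
  have "(\<lambda>z\<in>Z. a * f z) = (\<lambda>z\<in>Z. \<Sum>k=1..m. (a * c k) * p k z)"
    by (rule restrict_ext) (simp add: f sum_distrib_left mult.assoc)
  moreover have "\<forall>k\<in>{1..m}. p k \<in> A \<and> a * c k > 0" using m a by simp
  ultimately show "(\<lambda>z\<in>Z. a * f z) \<in> posi Z A"
    unfolding posi_def mem_Collect_eq using m(1)
    by (intro exI[of _ m] exI[of _ "\<lambda>k. a * c k"] exI[of _ p]) simp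
qed

section \<open>Cones under weighted substitution\<close>

text \<open>Multiplying by a fixed weight after substituting \<open>h\<close> is linear in
  \<open>f\<close>. An indicator as weight gives block gambles, the weight 1 gives flattening. That
  \<open>h\<close> maps into \<open>T\<close> lets sums restricted to \<open>T\<close> be evaluated
  at \<open>h x\<close>.\<close>

lemma gamble_cone_vimage:
  assumes h: "h ` S \<subseteq> T" and K: "gamble_cone S K"
  shows "gamble_cone T {f \<in> gambles T. (\<lambda>x\<in>S. w x * f (h x)) \<in> K}"
proof (rule gamble_coneI)
  fix f g assume "f \<in> {f \<in> gambles T. (\<lambda>x\<in>S. w x * f (h x)) \<in> K}"
    "g \<in> {f \<in> gambles T. (\<lambda>x\<in>S. w x * f (h x)) \<in> K}"
  then have "(\<lambda>x\<in>S. w x * f (h x)) \<in> K" "(\<lambda>x\<in>S. w x * g (h x)) \<in> K" by simp_all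
  then have "(\<lambda>x\<in>S. (\<lambda>x\<in>S. w x * f (h x)) x + (\<lambda>x\<in>S. w x * g (h x)) x) \<in> K"
    by (rule gamble_cone_add[OF K])
  moreover have "(\<lambda>x\<in>S. (\<lambda>x\<in>S. w x * f (h x)) x + (\<lambda>x\<in>S. w x * g (h x)) x)
      = (\<lambda>x\<in>S. w x * (\<lambda>z\<in>T. f z + g z) (h x))"
    using h by (intro restrict_ext) (simp add: image_subset_iff algebra_simps)
  ultimately show "(\<lambda>z\<in>T. f z + g z) \<in> {f \<in> gambles T. (\<lambda>x\<in>S. w x * f (h x)) \<in> K}"
    by (simp only: mem_Collect_eq restrict_in_gambles simp_thms)
next
  fix c :: real and f assume c: "c > 0" and "f \<in> {f \<in> gambles T. (\<lambda>x\<in>S. w x * f (h x)) \<in> K}"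
  then have "(\<lambda>x\<in>S. w x * f (h x)) \<in> K" by simp
  with c have "(\<lambda>x\<in>S. c * (\<lambda>x\<in>S. w x * f (h x)) x) \<in> K"
    by (rule gamble_cone_scale[OF K])
  moreover have "(\<lambda>x\<in>S. c * (\<lambda>x\<in>S. w x * f (h x)) x)
      = (\<lambda>x\<in>S. w x * (\<lambda>z\<in>T. c * f z) (h x))"
    using h by (intro restrict_ext) (simp add: image_subset_iff)
  ultimately show "(\<lambda>z\<in>T. c * f z) \<in> {f \<in> gambles T. (\<lambda>x\<in>S. w x * f (h x)) \<in> K}"
    by (simp only: mem_Collect_eq restrict_in_gambles simp_thms)
qed auto

lemma gamble_cone_image:
  assumes h: "h ` S \<subseteq> T" and K: "gamble_cone T K"
  shows "gamble_cone S ((\<lambda>f. \<lambda>x\<in>S. f (h x)) ` K)"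
proof (rule gamble_coneI)
  fix f g assume "f \<in> (\<lambda>f. \<lambda>x\<in>S. f (h x)) ` K" "g \<in> (\<lambda>f. \<lambda>x\<in>S. f (h x)) ` K"
  then obtain p q where p: "p \<in> K" "f = (\<lambda>x\<in>S. p (h x))" and q: "q \<in> K" "g = (\<lambda>x\<in>S. q (h x))"
    by blast
  have "(\<lambda>x\<in>S. f x + g x) = (\<lambda>x\<in>S. (\<lambda>z\<in>T. p z + q z) (h x))"
    using h by (intro restrict_ext) (simp add: p q image_subset_iff)
  then show "(\<lambda>x\<in>S. f x + g x) \<in> (\<lambda>f. \<lambda>x\<in>S. f (h x)) ` K"
    using gamble_cone_add[OF K p(1) q(1)] by blast
next
  fix c :: real and f assume c: "c > 0" and "f \<in> (\<lambda>f. \<lambda>x\<in>S. f (h x)) ` K"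
  then obtain p where p: "p \<in> K" "f = (\<lambda>x\<in>S. p (h x))"
    by blast
  have "(\<lambda>x\<in>S. c * f x) = (\<lambda>x\<in>S. (\<lambda>z\<in>T. c * p z) (h x))"
    using h by (intro restrict_ext) (simp add: p image_subset_iff)
  then show "(\<lambda>x\<in>S. c * f x) \<in> (\<lambda>f. \<lambda>x\<in>S. f (h x)) ` K"
    using gamble_cone_scale[OF K c p(1)] by blast
qed auto

text \<open>Gambles agree outside \<open>Z\<close>, so a gamble other than zero is nonzero at some
  point of \<open>Z\<close>, hence strictly positive there if it is nonnegative.\<close>

lemma pos_gambles_iff:
  "f \<in> pos_gambles Z \<longleftrightarrow> f \<in> gambles Z \<and> (\<forall>z\<in>Z. f z \<ge> 0) \<and> (\<exists>z\<in>Z. f z > 0)"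
proof (cases "f \<in> gambles Z")
  case True
  then have "f = zero_gamble Z \<longleftrightarrow> (\<forall>z\<in>Z. f z = 0)"
    by (auto simp: zero_gamble_def gambles_def fun_eq_iff PiE_iff extensional_def)
  with True show ?thesis
    by (force simp: pos_gambles_def zero_gamble_def order.order_iff_strict)
qed (simp add: pos_gambles_def)

section \<open>The independent natural extension as a least cone\<close>

definition irr_generator ::
    "('i \<Rightarrow> 'a set) \<Rightarrow> 'i set \<Rightarrow> 'i \<Rightarrow> ('i \<Rightarrow> 'a) \<Rightarrow> ('a \<Rightarrow> real) \<Rightarrow> ('i \<Rightarrow> 'a) \<Rightarrow> real" where
  "irr_generator X N n y g = (\<lambda>x\<in>PiE N X. indicator {y} (restrict x (N - {n})) * g (x n))"

lemma irr_gambles_eq: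
  "irr_gambles X N D n =
     posi (PiE N X) {irr_generator X N n y g | g y. g \<in> D n \<and> y \<in> PiE (N - {n}) X}"
  by (simp add: irr_gambles_def irr_generator_def)

lemma irr_generator_in_gambles: "irr_generator X N n y g \<in> gambles (PiE N X)"
  by (simp add: irr_generator_def)

lemma gamble_cone_ind_nat_ext: "gamble_cone (PiE N X) (ind_nat_ext X N D)"
  by (simp add: ind_nat_ext_def gamble_cone_posi)

lemma ind_nat_ext_superset:
  "pos_gambles (PiE N X) \<union> (\<Union>n\<in>N. irr_gambles X N D n) \<subseteq> ind_nat_ext X N D"
  unfolding ind_nat_ext_def
proof (rule posi_superset)
  have "irr_gambles X N D n \<subseteq> gambles (PiE N X)" for n
    unfolding irr_gambles_eq by (rule gamble_cone_subset[OF gamble_cone_posi])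
  moreover have "pos_gambles (PiE N X) \<subseteq> gambles (PiE N X)"
    by (auto simp: pos_gambles_iff)
  ultimately show "pos_gambles (PiE N X) \<union> (\<Union>n\<in>N. irr_gambles X N D n) \<subseteq> gambles (PiE N X)"
    by blast
qed

lemma pos_gambles_ind_nat_ext: "f \<in> pos_gambles (PiE N X) \<Longrightarrow> f \<in> ind_nat_ext X N D"
  using ind_nat_ext_superset by blast

lemma irr_generator_ind_nat_ext:
  assumes "n \<in> N" "g \<in> D n" "y \<in> PiE (N - {n}) X"
  shows "irr_generator X N n y g \<in> ind_nat_ext X N D"
proof -
  let ?G = "{irr_generator X N n y g | g y. g \<in> D n \<and> y \<in> PiE (N - {n}) X}"
  have "?G \<subseteq> gambles (PiE N X)"
    by (rule subsetI, elim CollectE exE conjE, hypsubst, rule irr_generator_in_gambles)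
  then have "?G \<subseteq> irr_gambles X N D n"
    unfolding irr_gambles_eq by (rule posi_superset)
  also have "irr_gambles X N D n \<subseteq> ind_nat_ext X N D"
    using \<open>n \<in> N\<close> ind_nat_ext_superset[of N X D] by (simp only: Un_subset_iff UN_subset_iff)
  finally show ?thesis using assms(2,3) by auto
qed

text \<open>The inner hulls \<open>irr_gambles\<close> are absorbed because \<open>K\<close> is a
  cone itself. This serves as the induction principle for the extension: a property that defines a
  cone has to be checked on positive gambles and single generators only.\<close>

lemma ind_nat_ext_least:
  assumes K: "gamble_cone (PiE N X) K"
    and "pos_gambles (PiE N X) \<subseteq> K"
    and "\<And>n g y. n \<in> N \<Longrightarrow> g \<in> D n \<Longrightarrow> y \<in> PiE (N - {n}) X \<Longrightarrow> irr_generator X N n y g \<in> K"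
  shows "ind_nat_ext X N D \<subseteq> K"
proof -
  have "irr_gambles X N D n \<subseteq> K" if "n \<in> N" for n
    unfolding irr_gambles_eq using assms(3)[OF that] by (intro posi_least[OF K]) blast
  with assms(2) show ?thesis
    unfolding ind_nat_ext_def by (intro posi_least[OF K]) blast
qed

section \<open>Two blocks\<close>

text \<open>Read on the joint space, this is a generator of the two-block extension that belongs to
  the block \<open>R\<close>, with \<open>u\<close> a point of the other block.\<close>

definition block_gamble ::
    "('i \<Rightarrow> 'a set) \<Rightarrow> 'i set \<Rightarrow> 'i set \<Rightarrow> ('i \<Rightarrow> 'a) \<Rightarrow> (('i \<Rightarrow> 'a) \<Rightarrow> real) \<Rightarrow> ('i \<Rightarrow> 'a) \<Rightarrow> real" where
  "block_gamble X R S u g = (\<lambda>x\<in>PiE (R \<union> S) X. indicator {u} (restrict x S) * g (restrict x R))"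

lemma restrict_PiE_subset: "x \<in> PiE A X \<Longrightarrow> B \<subseteq> A \<Longrightarrow> restrict x B \<in> PiE B X"
  by (auto simp: restrict_PiE_iff)

lemma PiE_merge:
  assumes "A \<inter> B = {}" "v \<in> PiE A X" "u \<in> PiE B X"
  obtains x where "x \<in> PiE (A \<union> B) X" "restrict x A = v" "restrict x B = u"
proof
  define x where "x = (\<lambda>i\<in>A \<union> B. if i \<in> A then v i else u i)"
  show "x \<in> PiE (A \<union> B) X"
    using assms by (auto simp: x_def restrict_PiE_iff PiE_mem)
  show "restrict x A = v"
    using PiE_arb[OF assms(2)] by (auto simp: x_def fun_eq_iff)
  show "restrict x B = u"
    using PiE_arb[OF assms(3)] assms(1) by (auto simp: x_def fun_eq_iff)
qed

text \<open>A point of \<open>R \<union> S - {n}\<close> is a pair of a point of \<open>S\<close>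
  and a point of \<open>R - {n}\<close>, and its indicator is the product of the two
  indicators.\<close>

lemma irr_generator_Un:
  assumes n: "n \<in> R" and disj: "R \<inter> S = {}" and y: "y \<in> PiE (R \<union> S - {n}) X"
  shows "irr_generator X (R \<union> S) n y g =
    block_gamble X R S (restrict y S) (irr_generator X R n (restrict y (R - {n})) g)"
  unfolding irr_generator_def block_gamble_def
proof (rule restrict_ext)
  fix x assume x: "x \<in> PiE (R \<union> S) X"
  \<comment> \<open>As \<open>n\<close> lies in \<open>R\<close>, it is not in \<open>S\<close>, so
    its removal leaves the block \<open>S\<close> whole.\<close>
  have eq: "R \<union> S - {n} = (R - {n}) \<union> S" using n disj by blast
  have "restrict x (R \<union> S - {n}) = y \<longleftrightarrow> (\<forall>i\<in>R \<union> S - {n}. x i = y i)"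
    using PiE_arb[OF y] by (auto simp: fun_eq_iff)
  also have "\<dots> \<longleftrightarrow> restrict x S = restrict y S \<and> restrict x (R - {n}) = restrict y (R - {n})"
    unfolding eq by (auto simp: restrict_def fun_eq_iff)
  finally have iff: "restrict x (R \<union> S - {n}) = y \<longleftrightarrow> \<dots>" .
  have "restrict (restrict x R) (R - {n}) = restrict x (R - {n})"
    by (auto simp: restrict_def fun_eq_iff)
  moreover have "restrict x R \<in> PiE R X"
    using x by (rule restrict_PiE_subset) simp
  ultimately show "indicator {y} (restrict x (R \<union> S - {n})) * g (x n) =
    indicator {restrict y S} (restrict x S) *
      (\<lambda>x\<in>PiE R X. indicator {restrict y (R - {n})} (restrict x (R - {n})) * g (x n)) (restrict x R)"
    using n by (simp add: indicator_def iff)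
qed

text \<open>For fixed \<open>u\<close> the block gamble is linear in \<open>g\<close>, so leastness
  reduces the claim to positive gambles and generators. This covers every \<open>g\<close> in the
  extension over \<open>R\<close>, as the two-block construction builds its generators from all of
  them.\<close>

lemma block_gamble_ind_nat_ext:
  assumes disj: "R \<inter> S = {}" and u: "u \<in> PiE S X" and g: "g \<in> ind_nat_ext X R D"
  shows "block_gamble X R S u g \<in> ind_nat_ext X (R \<union> S) D"
proof -
  let ?K = "{f \<in> gambles (PiE R X). block_gamble X R S u f \<in> ind_nat_ext X (R \<union> S) D}"
  have "ind_nat_ext X R D \<subseteq> ?K"
  proof (rule ind_nat_ext_least)
    show "gamble_cone (PiE R X) ?K"
      unfolding block_gamble_def
      by (rule gamble_cone_vimage[OF _ gamble_cone_ind_nat_ext]) (auto simp: restrict_PiE_iff)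
  next
    show "pos_gambles (PiE R X) \<subseteq> ?K"
    proof
      fix f assume f: "f \<in> pos_gambles (PiE R X)"
      then obtain v where v: "v \<in> PiE R X" "f v > 0" by (auto simp: pos_gambles_iff)
      \<comment> \<open>Strict positivity needs a joint point that both extends \<open>v\<close> and
        passes the indicator of \<open>u\<close>; disjointness of the blocks provides it.\<close>
      obtain x where x: "x \<in> PiE (R \<union> S) X" "restrict x R = v" "restrict x S = u"
        using PiE_merge[OF disj v(1) u] .
      then have "block_gamble X R S u f x > 0" using v by (simp add: block_gamble_def)
      moreover have "block_gamble X R S u f x \<ge> 0" if "x \<in> PiE (R \<union> S) X" for x
        using f that restrict_PiE_subset[OF that, of R]
        by (auto simp: block_gamble_def pos_gambles_iff indicator_def)
      ultimately have "block_gamble X R S u f \<in> pos_gambles (PiE (R \<union> S) X)"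
        using x(1) by (auto simp: pos_gambles_iff block_gamble_def)
      then show "f \<in> ?K" using f by (simp add: pos_gambles_ind_nat_ext pos_gambles_iff)
    qed
  next
    fix n h w assume n: "n \<in> R" and h: "h \<in> D n" and w: "w \<in> PiE (R - {n}) X"
    have eq: "(R - {n}) \<union> S = R \<union> S - {n}" and disj': "(R - {n}) \<inter> S = {}"
      using n disj by blast+
    \<comment> \<open>Gluing \<open>w\<close> and \<open>u\<close> gives the point whose generator
      over \<open>R \<union> S\<close> factors into the indicator of \<open>u\<close> and the given
      generator over \<open>R\<close>.\<close>
    obtain y where y: "y \<in> PiE (R \<union> S - {n}) X" "restrict y (R - {n}) = w" "restrict y S = u"
      using PiE_merge[OF disj' w u] unfolding eq .
    have "irr_generator X (R \<union> S) n y h \<in> ind_nat_ext X (R \<union> S) D"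
      using n h y(1) by (intro irr_generator_ind_nat_ext) auto
    then show "irr_generator X R n w h \<in> ?K"
      using irr_generator_Un[OF n disj y(1), of h] y by (simp add: irr_generator_in_gambles)
  qed
  with g show ?thesis by blast
qed

section \<open>Transfer between the two-block space and the joint space\<close>

text \<open>With \<open>R\<close> removed, \<open>S\<close> is the only remaining index, so
  \<open>y\<close> carries just the value \<open>y S\<close>; the \<open>S\<close>-component of a
  regrouped \<open>x\<close> is \<open>restrict x S\<close>.\<close>

lemma flatten_irr_generator:
  assumes "R \<noteq> S" "y \<in> PiE ({R, S} - {R}) (\<lambda>R. PiE R X)"
  shows "flatten_gamble X {R, S} (irr_generator (\<lambda>R. PiE R X) {R, S} R y g) =
    block_gamble X R S (y S) g"
proof -
  have eq: "{R, S} - {R} = {S}" using assms(1) by blast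
  have "regroup {R, S} x \<in> PiE {R, S} (\<lambda>R. PiE R X)" if "x \<in> PiE (R \<union> S) X" for x
    using that by (auto simp: regroup_def restrict_PiE_iff)
  moreover have "restrict (regroup {R, S} x) {S} = y \<longleftrightarrow> restrict x S = y S" for x
    using PiE_arb[OF assms(2)] by (auto simp: regroup_def fun_eq_iff eq)
  ultimately show ?thesis
    unfolding flatten_gamble_def irr_generator_def block_gamble_def eq
    by (auto intro!: restrict_ext simp: indicator_def regroup_def)
qed

text \<open>Generators for the inclusion of the flattened extension in the joint one. The ordered
  pair of \<open>R\<close> and \<open>S\<close> allows use for either block by swapping
  roles.\<close>

lemma flatten_irr_generator_ind_nat_ext:
  assumes "R \<noteq> S" "R \<inter> S = {}" "y \<in> PiE ({R, S} - {R}) (\<lambda>R. PiE R X)" "g \<in> ind_nat_ext X R D"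
  shows "flatten_gamble X {R, S} (irr_generator (\<lambda>R. PiE R X) {R, S} R y g)
    \<in> ind_nat_ext X (R \<union> S) D"
proof -
  have "y S \<in> PiE S X" using assms(1,3) by auto
  with assms show ?thesis
    by (simp add: flatten_irr_generator block_gamble_ind_nat_ext del: insert_Diff_single)
qed

text \<open>Generators for the converse inclusion: the factorization over \<open>R\<close> and
  \<open>S\<close> is read backwards, its second factor being a generator over \<open>R\<close> and
  hence an admissible gamble of that block.\<close>

lemma irr_generator_in_flatten:
  assumes "R \<noteq> S" "R \<inter> S = {}" "n \<in> R" "g \<in> D n" "y \<in> PiE (R \<union> S - {n}) X"
  shows "irr_generator X (R \<union> S) n y g \<in> flatten_gamble X {R, S} `
    ind_nat_ext (\<lambda>R. PiE R X) {R, S} (\<lambda>R. ind_nat_ext X R D)"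
proof -
  let ?h = "irr_generator X R n (restrict y (R - {n})) g"
  \<comment> \<open>The part of \<open>y\<close> on \<open>S\<close>, repackaged as a point of the
    product over the single remaining block.\<close>
  let ?v = "\<lambda>Q\<in>{R, S} - {R}. restrict y Q"
  have h: "?h \<in> ind_nat_ext X R D"
    using assms by (intro irr_generator_ind_nat_ext restrict_PiE_subset[OF assms(5)]) auto
  have v: "?v \<in> PiE ({R, S} - {R}) (\<lambda>R. PiE R X)"
  proof (rule restrict_PiE_iff[THEN iffD2], rule ballI)
    fix Q assume "Q \<in> {R, S} - {R}"
    then show "restrict y Q \<in> PiE Q X"
      using assms by (intro restrict_PiE_subset[OF assms(5)]) auto
  qed
  have "irr_generator X (R \<union> S) n y g =
      flatten_gamble X {R, S} (irr_generator (\<lambda>R. PiE R X) {R, S} R ?v ?h)"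
    unfolding flatten_irr_generator[OF assms(1) v] irr_generator_Un[OF assms(3,2,5)]
    using assms(1) by simp
  moreover have "irr_generator (\<lambda>R. PiE R X) {R, S} R ?v ?h
      \<in> ind_nat_ext (\<lambda>R. PiE R X) {R, S} (\<lambda>R. ind_nat_ext X R D)"
    using h v by (rule irr_generator_ind_nat_ext[rotated]) simp
  ultimately show ?thesis by blast
qed

text \<open>Regrouping is onto the two-block space, so flattening preserves and reflects positivity;
  every joint gamble is a flattened one, which gives equality of the sets.\<close>

lemma flatten_pos_gambles:
  assumes "N1 \<inter> N2 = {}"
  shows "flatten_gamble X {N1, N2} ` pos_gambles (PiE {N1, N2} (\<lambda>R. PiE R X))
    = pos_gambles (PiE (N1 \<union> N2) X)"
proof -
  let ?S = "PiE (N1 \<union> N2) X" and ?T = "PiE {N1, N2} (\<lambda>R. PiE R X)"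
  have img: "regroup {N1, N2} ` ?S = ?T"
    using bij_betw_regroup[OF assms] by (rule bij_betw_imp_surj_on)
  have pos: "flatten_gamble X {N1, N2} f \<in> pos_gambles ?S \<longleftrightarrow> f \<in> pos_gambles ?T"
    if "f \<in> gambles ?T" for f
    using that unfolding pos_gambles_iff img[symmetric] by (simp add: flatten_gamble_def)
  have surj: "flatten_gamble X {N1, N2} ` gambles ?T = gambles ?S"
    using bij_betw_flatten_gamble[OF assms] by (rule bij_betw_imp_surj_on)
  have "pos_gambles ?T = {f \<in> gambles ?T. flatten_gamble X {N1, N2} f \<in> pos_gambles ?S}"
    using pos by (auto simp: pos_gambles_def)
  then have "flatten_gamble X {N1, N2} ` pos_gambles ?T
      = flatten_gamble X {N1, N2} ` gambles ?T \<inter> pos_gambles ?S"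
    by (simp only: image_def) blast
  then show ?thesis
    unfolding surj by (auto simp: pos_gambles_def)
qed

theorem theorem20:
  fixes N1 N2 :: "'i set"
    and X :: "'i \<Rightarrow> 'a set"
    and D :: "'i \<Rightarrow> ('a \<Rightarrow> real) set"
  assumes "finite N1" "N1 \<noteq> {}"
    and "finite N2" "N2 \<noteq> {}"
    and "N1 \<inter> N2 = {}"
    and "\<And>n. n \<in> N1 \<union> N2 \<Longrightarrow> finite (X n) \<and> X n \<noteq> {}"
    and "\<And>n. n \<in> N1 \<union> N2 \<Longrightarrow> coherent (X n) (D n)"
  shows "flatten_gamble X {N1, N2} `
           ind_nat_ext (\<lambda>R. PiE R X) {N1, N2} (\<lambda>R. ind_nat_ext X R D)
         = ind_nat_ext X (N1 \<union> N2) D"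
proof
  note disj = \<open>N1 \<inter> N2 = {}\<close>
  then have disj': "N2 \<inter> N1 = {}" by blast
  \<comment> \<open>Disjoint blocks of which one is non-empty are distinct, so the index set
    \<open>{N1, N2}\<close> really has two elements.\<close>
  have ne: "N1 \<noteq> N2" "N2 \<noteq> N1" using disj \<open>N1 \<noteq> {}\<close> by auto
  let ?S = "PiE (N1 \<union> N2) X" and ?T = "PiE {N1, N2} (\<lambda>R. PiE R X)"
  let ?L = "ind_nat_ext (\<lambda>R. PiE R X) {N1, N2} (\<lambda>R. ind_nat_ext X R D)"
  let ?U = "ind_nat_ext X (N1 \<union> N2) D"
  have reg: "regroup {N1, N2} ` ?S \<subseteq> ?T"
    using bij_betw_imp_surj_on[OF bij_betw_regroup[OF disj, of X]] by simp
  have flat: "flatten_gamble X {N1, N2} = (\<lambda>f. \<lambda>x\<in>?S. f (regroup {N1, N2} x))"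
    by (simp add: flatten_gamble_def fun_eq_iff)
  \<comment> \<open>The preimage of the joint extension under flattening; leastness of the two-block
    extension turns the first inclusion into membership of generators in \<open>?K\<close>.\<close>
  let ?K = "{f \<in> gambles ?T. flatten_gamble X {N1, N2} f \<in> ?U}"
  have "?L \<subseteq> ?K"
  proof (rule ind_nat_ext_least)
    show "gamble_cone ?T ?K"
      using gamble_cone_vimage[OF reg gamble_cone_ind_nat_ext, of "\<lambda>_. 1" D] by (simp add: flat)
    show "pos_gambles ?T \<subseteq> ?K"
    proof
      fix f assume f: "f \<in> pos_gambles ?T"
      then have "flatten_gamble X {N1, N2} f \<in> pos_gambles ?S"
        unfolding flatten_pos_gambles[OF disj, symmetric] by (rule imageI)
      then have "flatten_gamble X {N1, N2} f \<in> ?U"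
        by (rule pos_gambles_ind_nat_ext)
      moreover have "f \<in> gambles ?T"
        using f unfolding pos_gambles_iff by (rule conjunct1)
      ultimately show "f \<in> ?K"
        by (intro CollectI conjI)
    qed
  next
    fix R g y
    assume R: "R \<in> {N1, N2}" and g: "g \<in> ind_nat_ext X R D"
      and y: "y \<in> PiE ({N1, N2} - {R}) (\<lambda>R. PiE R X)"
    have "flatten_gamble X {N1, N2} (irr_generator (\<lambda>R. PiE R X) {N1, N2} R y g) \<in> ?U"
    proof (cases "R = N1")
      case True
      show ?thesis
        unfolding True
        by (rule flatten_irr_generator_ind_nat_ext[OF ne(1) disj y[unfolded True] g[unfolded True]])
    next
      case False
      then have R2: "R = N2" using R by simp
      \<comment> \<open>The second block is the same case with the roles exchanged, since
        \<open>{N1, N2}\<close> and the union are symmetric.\<close>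
      from y have "y \<in> PiE ({N2, N1} - {N2}) (\<lambda>R. PiE R X)"
        unfolding R2 insert_commute[of N2 N1] .
      from flatten_irr_generator_ind_nat_ext[OF ne(2) disj' this g[unfolded R2]]
      show ?thesis
        unfolding R2 insert_commute[of N2 N1] Un_commute[of N2 N1] .
    qed
    then show "irr_generator (\<lambda>R. PiE R X) {N1, N2} R y g \<in> ?K"
      by (simp add: irr_generator_in_gambles)
  qed
  then show "flatten_gamble X {N1, N2} ` ?L \<subseteq> ?U" by blast
  \<comment> \<open>Here the image under flattening is the cone, tested against the generators of
    the joint extension.\<close>
  show "?U \<subseteq> flatten_gamble X {N1, N2} ` ?L"
  proof (rule ind_nat_ext_least)
    show "gamble_cone ?S (flatten_gamble X {N1, N2} ` ?L)"
      unfolding flat by (rule gamble_cone_image[OF reg gamble_cone_ind_nat_ext])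
    show "pos_gambles ?S \<subseteq> flatten_gamble X {N1, N2} ` ?L"
      unfolding flatten_pos_gambles[OF disj, symmetric]
      by (intro image_mono subsetI pos_gambles_ind_nat_ext)
  next
    fix n g y
    assume n: "n \<in> N1 \<union> N2" and g: "g \<in> D n" and y: "y \<in> PiE (N1 \<union> N2 - {n}) X"
    show "irr_generator X (N1 \<union> N2) n y g \<in> flatten_gamble X {N1, N2} ` ?L"
    proof (cases "n \<in> N1")
      case True
      show ?thesis
        by (rule irr_generator_in_flatten[where D = D, OF ne(1) disj True g y])
    next
      case False
      then have n2: "n \<in> N2" using n by blast
      from y have "y \<in> PiE (N2 \<union> N1 - {n}) X"
        unfolding Un_commute[of N2 N1] .
      from irr_generator_in_flatten[where D = D, OF ne(2) disj' n2 g this]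
      show ?thesis
        unfolding insert_commute[of N2 N1] Un_commute[of N2 N1] .
    qed
  qed
qed

end
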